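(* Let $n\ge 3$. The inconsistency index $CI_n$ is a convex function of the logarithmized matrix elements; that is, the function $X\mapsto CI_n(\exp X)$ is convex on the linear space $\log{\cal P}_n$.
   Context: ${\cal P}_n$ is the set of $n\times n$ pairwise comparison matrices: real matrices $A=(a_{ij})$ with $a_{ij}>0$ and $a_{ij}=1/a_{ji}$ for all $i,j$. Exponentials and logarithms of matrices are taken entrywise: $\exp X=(e^{x_{ij}})$ and $\log A=(\log a_{ij})$. $\log{\cal P}_n=\{\log A : A\in{\cal P}_n\}$ is the linear space of real skew-symmetric $n\times n$ matrices. The triads of $A\in{\cal P}_n$ are its $NT(n)=\binom n3$ principal $3\times3$ submatrices $\Gamma_1,\dots,\Gamma_{NT(n)}$ (one for each $1\le i<j<k\le n$, formed by rows and columns $i,j,k$). The inconsistency index of Pel\'aez and Lamata is $CI_n(A)=\det(A)$ for $n=3$ and $CI_n(A)=\frac{1}{NT(n)}\sum_{i=1}^{NT(n)}\det(\Gamma_i)$ for $n>3$. *)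

theory Defs
  imports "HOL-Analysis.Analysis"
begin

text \<open>
  An \<open>n \<times> n\<close> matrix is an element of \<open>real^'n^'n\<close> with \<open>n = CARD('n)\<close>; the index type
  carries a linear order so that the triples \<open>i < j < k\<close> make sense. The numeral
  types provide such an index type for every \<open>n \<ge> 1\<close>.
\<close>

definition mat_exp :: "real^'n^'n \<Rightarrow> real^'n^'n" where
  "mat_exp X = (\<chi> i j. exp (X $ i $ j))"

definition mat_log :: "real^'n^'n \<Rightarrow> real^'n^'n" where
  "mat_log A = (\<chi> i j. ln (A $ i $ j))"

definition pairwise_comparison_matrices :: "(real^'n^'n) set" where
  "pairwise_comparison_matrices =
     {A. \<forall>i j. A $ i $ j > 0 \<and> A $ i $ j = 1 / A $ j $ i}"

definition log_pairwise_comparison_matrices :: "(real^'n^'n) set" where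
  "log_pairwise_comparison_matrices = mat_log ` pairwise_comparison_matrices"

definition triad :: "real^'n^'n \<Rightarrow> 'n \<Rightarrow> 'n \<Rightarrow> 'n \<Rightarrow> real^3^3" where
  "triad A i j k =
     (let r = (\<lambda>p::3. if p = 1 then i else if p = 2 then j else k)
      in \<chi> p q. A $ r p $ r q)"

text \<open>The second branch is meant for \<open>n > 3\<close>; for \<open>n < 3\<close> the value is irrelevant.\<close>

definition CI :: "real^'n::{finite,linorder}^'n::{finite,linorder} \<Rightarrow> real" where
  "CI A =
     (if CARD('n) = 3 then det A
      else 1 / real (CARD('n) choose 3) *
           (\<Sum>(i, j, k)\<in>{(i, j, k). i < j \<and> j < k}. det (triad A i j k)))"

lemma log_pairwise_comparison_matrices_eq_skew:
  "log_pairwise_comparison_matrices = {X :: real^'n^'n. transpose X = - X}"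
proof (intro equalityI subsetI)
  fix X :: "real^'n^'n" assume "X \<in> log_pairwise_comparison_matrices"
  then obtain A :: "real^'n^'n" where A: "A \<in> pairwise_comparison_matrices" and X: "X = mat_log A"
    unfolding log_pairwise_comparison_matrices_def by (rule imageE)
  have pos: "A $ i $ j > 0" and recip: "A $ j $ i = 1 / A $ i $ j" for i j
    using A unfolding pairwise_comparison_matrices_def by (blast+)
  have "ln (A $ j $ i) = - ln (A $ i $ j)" for i j
    unfolding recip[of j i] using pos[of i j] by (simp add: ln_div)
  then show "X \<in> {X. transpose X = - X}"
    unfolding mem_Collect_eq X mat_log_def transpose_def vec_eq_iff vec_lambda_beta
      vector_uminus_component by blast
next
  fix X :: "real^'n^'n" assume "X \<in> {X. transpose X = - X}"
  then have eq: "transpose X = - X" by simp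
  have skew: "X $ j $ i = - X $ i $ j" for i j
    using arg_cong[OF eq, of "\<lambda>M. M $ i $ j"] by (simp add: transpose_def)
  have "exp (X $ i $ j) = 1 / exp (X $ j $ i)" for i j
    unfolding skew[of i j] by (simp add: exp_minus divide_inverse)
  then have "mat_exp X \<in> pairwise_comparison_matrices"
    unfolding pairwise_comparison_matrices_def mat_exp_def mem_Collect_eq vec_lambda_beta
    by (intro allI conjI exp_gt_zero)
  moreover have "X = mat_log (mat_exp X)"
    by (simp add: mat_log_def mat_exp_def vec_eq_iff)
  ultimately show "X \<in> log_pairwise_comparison_matrices"
    unfolding log_pairwise_comparison_matrices_def by blast
qed

lemma subspace_log_pairwise_comparison_matrices:
  "subspace (log_pairwise_comparison_matrices :: (real^'n^'n) set)"
proof -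
  have "transpose (X + Y) = transpose X + transpose Y" "transpose (c *\<^sub>R X) = c *\<^sub>R transpose X"
    "transpose (0 :: real^'n^'n) = 0" for X Y :: "real^'n^'n" and c
    by (simp_all add: transpose_def vec_eq_iff)
  then show ?thesis
    unfolding log_pairwise_comparison_matrices_eq_skew subspace_def by simp
qed

end

theory Submission
  imports Defs
begin

text \<open>
  In the Leibniz expansion of the determinant of a triad \<open>i, j, k\<close> of a pairwise comparison
  matrix \<open>exp X\<close>, reciprocity makes most terms constant: the identity gives \<open>1\<close> and each of the
  three transpositions gives \<open>-1\<close>. The two 3-cycles use reciprocal entries, so they give \<open>exp s\<close>
  and \<open>exp (- s)\<close> with \<open>s = X\<^sub>i\<^sub>j + X\<^sub>j\<^sub>k - X\<^sub>i\<^sub>k\<close>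
  (lemma \<open>det_triad_mat_exp\<close>). So every triad contributes \<open>2 cosh s - 2\<close> where \<open>s\<close> is linear
  in \<open>X\<close>, a convex function, and \<open>CI\<close> is a combination of these with nonnegative coefficients.
  For \<open>n = 3\<close> the matrix itself is, up to the naming of its indices, its only triad, so
  lemma \<open>det_eq_det_triad\<close> reduces this case to the same formula.
\<close>

lemma triad_nth:
  "triad A i j k $ 1 = (\<chi> q. A $ i $ (if q = 1 then i else if q = 2 then j else k))"
  "triad A i j k $ 2 = (\<chi> q. A $ j $ (if q = 1 then i else if q = 2 then j else k))"
  "triad A i j k $ 3 = (\<chi> q. A $ k $ (if q = 1 then i else if q = 2 then j else k))"
  by (simp_all add: triad_def Let_def)

text \<open>
  The index type need not be \<open>3\<close> itself, so the Leibniz formula is expanded over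
  an enumeration of its three elements and compared with the expansion over \<open>3\<close>.
\<close>
lemma det_eq_det_triad:
  fixes A :: "real^'n::finite^'n::finite"
  assumes univ: "(UNIV :: 'n set) = {i, j, k}" and dist: "i \<noteq> j" "i \<noteq> k" "j \<noteq> k"
  shows "det A = det (triad A i j k)"
proof -
  have ijk: "finite {j, k}" "i \<notin> {j, k}" and jk: "finite {k}" "j \<notin> {k}"
    using dist by auto
  have "det A =
      A$i$i * A$j$j * A$k$k + A$i$j * A$j$k * A$k$i + A$i$k * A$j$i * A$k$j
      - A$i$i * A$j$k * A$k$j - A$i$j * A$j$i * A$k$k - A$i$k * A$j$j * A$k$i"
    unfolding det_def univ
    unfolding sum_over_permutations_insert[OF ijk]
    unfolding sum_over_permutations_insert[OF jk]
    unfolding permutes_sing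
    using dist dist[symmetric]
    by (simp add: sign_swap_id permutation_swap_id sign_compose sign_id swap_id_eq)
  then show ?thesis
    unfolding det_3 triad_nth by simp
qed

lemma det_triad_mat_exp:
  fixes X :: "real^'n^'n"
  assumes "X \<in> log_pairwise_comparison_matrices"
  shows "det (triad (mat_exp X) i j k) =
    exp (X$i$j + X$j$k - X$i$k) + exp (- (X$i$j + X$j$k - X$i$k)) - 2"
proof -
  have eq: "transpose X = - X"
    using assms by (simp add: log_pairwise_comparison_matrices_eq_skew)
  have skew: "X $ q $ p = - X $ p $ q" for p q
    using arg_cong[OF eq, of "\<lambda>M. M $ p $ q"] by (simp add: transpose_def)
  have diag: "X $ p $ p = 0" for p
    using skew[of p p] by simp
  show ?thesis
    unfolding det_3 triad_nth
    by (simp add: mat_exp_def diag skew[of j i] skew[of k i] skew[of k j]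
        exp_add exp_diff exp_minus field_simps)
qed

lemma convex_on_exp_linear:
  assumes "linear f" "convex S"
  shows "convex_on S (\<lambda>x. exp (f x :: real))"
proof (rule convex_onI[OF _ assms(2)])
  fix t :: real and x y
  assume "0 < t" "t < 1"
  then show "exp (f ((1 - t) *\<^sub>R x + t *\<^sub>R y)) \<le> (1 - t) * exp (f x) + t * exp (f y)"
    using convex_onD[OF exp_convex, of t "f x" "f y"] assms(1)
    by (simp add: linear_add linear_scale)
qed

lemma convex_on_sum_functions:
  assumes "finite I" "convex S" "\<And>i. i \<in> I \<Longrightarrow> convex_on S (f i)"
  shows "convex_on S (\<lambda>x. \<Sum>i\<in>I. f i x)"
  using assms(1,3) by induction (auto simp: convex_on_const assms(2))

lemma convex_on_det_triad:
  "convex_on log_pairwise_comparison_matrices (\<lambda>X :: real^'n^'n. det (triad (mat_exp X) i j k))"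
proof -
  let ?L = "log_pairwise_comparison_matrices :: (real^'n^'n) set"
  have cvx: "convex ?L"
    by (intro subspace_imp_convex subspace_log_pairwise_comparison_matrices)
  define s where "s = (\<lambda>X :: real^'n^'n. X$i$j + X$j$k - X$i$k)"
  have "linear s" "linear (\<lambda>X. - s X)"
    by (auto simp: s_def algebra_simps intro!: linearI)
  then have "convex_on ?L (\<lambda>X. exp (s X) + exp (- s X) + - 2)"
    by (intro convex_on_add convex_on_exp_linear convex_on_const[THEN iffD2] cvx)
  then show ?thesis
    using cvx by (simp add: convex_on_def convex_def det_triad_mat_exp s_def)
qed

theorem mainTheorem8:
  assumes "CARD('n::{finite,linorder}) \<ge> 3"
  shows "convex_on
           (log_pairwise_comparison_matrices :: (real^'n::{finite,linorder}^'n::{finite,linorder}) set)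
           (\<lambda>X. CI (mat_exp X))"
proof (cases "CARD('n) = 3")
  case True
  then obtain i j k where "(UNIV :: 'n set) = {i, j, k}" "i \<noteq> j" "i \<noteq> k" "j \<noteq> k"
    by (auto simp: card_3_iff)
  then show ?thesis
    using True convex_on_det_triad[of i j k] by (simp add: CI_def det_eq_det_triad)
next
  case False
  have "convex (log_pairwise_comparison_matrices
      :: (real^'n::{finite,linorder}^'n::{finite,linorder}) set)"
    by (intro subspace_imp_convex subspace_log_pairwise_comparison_matrices)
  then show ?thesis
    using False unfolding CI_def
    by (auto intro!: convex_on_cmul convex_on_sum_functions convex_on_det_triad)
qed

end
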